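(* Let $X$ and $Y$ be Banach spaces and $\kappa$ an infinite cardinal. If $X$ and $Y$ have the SD2P$_{<\kappa}$, then the projective tensor product $X\widehat{\otimes}_\pi Y$ has the SD2P$_{<\kappa}$.
   Context: Banach spaces are real and infinite-dimensional. $S_X$ is the unit sphere of $X$. For $B\subset X$, $A\subset X^*$ and $\lambda\in(0,1)$, $B$ $\lambda$-norms $A$ if for every $x^*\in A$ there is $x\in B\setminus\{0\}$ with $x^*(x)\ge\lambda\|x^*\|\|x\|$. For an infinite cardinal $\kappa$, $X$ has the SD2P$_{<\kappa}$ if for every set $A\subset S_{X^*}$ of cardinality strictly smaller than $\kappa$ and every $\lambda\in(0,1)$ there are $B\subset S_X$ and $x^*\in S_{X^*}$ such that $B$ $\lambda$-norms $A$ and $x^*(x)\ge\lambda$ for every $x\in B$. *)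

theory Defs
  imports "HOL-Analysis.Analysis"
begin

unbundle cardinal_syntax

section \<open>Norming functionals\<close>

text \<open>The consequence of the Hahn--Banach theorem that is needed to see that the projective
  tensor norm is definite and that a normed space embeds isometrically into its bidual.
  The functional is found as a minimal sublinear function below \<open>norm\<close>.\<close>

definition sublinear :: "('a::real_vector \<Rightarrow> real) \<Rightarrow> bool" where
  "sublinear q \<longleftrightarrow> (\<forall>x y. q (x + y) \<le> q x + q y) \<and> (\<forall>c\<ge>0. \<forall>x. q (c *\<^sub>R x) = c * q x)"

lemma sublinear_add: "sublinear q \<Longrightarrow> q (x + y) \<le> q x + q y"
  by (simp add: sublinear_def)

lemma sublinear_scale: "sublinear q \<Longrightarrow> c \<ge> 0 \<Longrightarrow> q (c *\<^sub>R x) = c * q x"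
  by (simp add: sublinear_def)

lemma sublinear_zero: "sublinear q \<Longrightarrow> q 0 = 0"
  using sublinear_scale[of q 0 0] by simp

lemma sublinear_minus: "sublinear q \<Longrightarrow> - q (- x) \<le> q x"
  using sublinear_add[of q x "- x"] sublinear_zero[of q] by simp

lemma sublinear_norm: "sublinear (norm :: 'a::real_normed_vector \<Rightarrow> real)"
  by (simp add: sublinear_def norm_triangle_ineq)

lemma sublinear_INF:
  fixes F :: "'i set" and q :: "'i \<Rightarrow> 'a::real_vector \<Rightarrow> real"
  assumes ne: "F \<noteq> {}" and bdd: "\<And>x. bdd_below ((\<lambda>i. q i x) ` F)"
    and sc: "\<And>i c x. i \<in> F \<Longrightarrow> c > 0 \<Longrightarrow> \<exists>j\<in>F. q j (c *\<^sub>R x) \<le> c * q i x"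
    and add: "\<And>i j x y. i \<in> F \<Longrightarrow> j \<in> F \<Longrightarrow> \<exists>k\<in>F. q k (x + y) \<le> q i x + q j y"
    and zero: "\<And>i. i \<in> F \<Longrightarrow> q i 0 = 0"
  shows "sublinear (\<lambda>x. INF i\<in>F. q i x)"
proof -
  let ?Q = "\<lambda>x. INF i\<in>F. q i x"
  have lo: "?Q x \<le> q i x" if "i \<in> F" for i x
    by (rule cINF_lower[OF bdd that])
  have le: "?Q (c *\<^sub>R x) \<le> c * ?Q x" if c: "c > 0" for c x
  proof -
    have "?Q (c *\<^sub>R x) / c \<le> ?Q x"
    proof (rule cINF_greatest[OF ne])
      fix i assume "i \<in> F"
      then obtain j where "j \<in> F" "q j (c *\<^sub>R x) \<le> c * q i x" using sc c by blast
      then have "?Q (c *\<^sub>R x) \<le> c * q i x" using lo[of j "c *\<^sub>R x"] by linarith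
      then show "?Q (c *\<^sub>R x) / c \<le> q i x" using c by (simp add: field_simps)
    qed
    then show ?thesis using c by (simp add: field_simps)
  qed
  have eq: "?Q (c *\<^sub>R x) = c * ?Q x" if c: "c > 0" for c x
  proof (rule antisym[OF le[OF c]])
    show "c * ?Q x \<le> ?Q (c *\<^sub>R x)"
      using le[of "inverse c" "c *\<^sub>R x"] c by (simp add: field_simps)
  qed
  have z: "?Q 0 = 0"
    using ne zero by simp
  have tri: "?Q (x + y) \<le> ?Q x + ?Q y" for x y
  proof -
    have "?Q (x + y) - ?Q y \<le> ?Q x"
    proof (rule cINF_greatest[OF ne])
      fix i assume i: "i \<in> F"
      have "?Q (x + y) - q i x \<le> ?Q y"
      proof (rule cINF_greatest[OF ne])
        fix j assume "j \<in> F"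
        then obtain k where "k \<in> F" "q k (x + y) \<le> q i x + q j y" using add i by blast
        then show "?Q (x + y) - q i x \<le> q j y" using lo[of k "x + y"] by linarith
      qed
      then show "?Q (x + y) - ?Q y \<le> q i x" by linarith
    qed
    then show ?thesis by linarith
  qed
  have "?Q (c *\<^sub>R x) = c * ?Q x" if "c \<ge> 0" for c x
    using that eq[of c x] z by (cases "c = 0") auto
  with tri show ?thesis by (simp add: sublinear_def)
qed

lemma sublinear_descend:
  fixes q :: "'a::real_vector \<Rightarrow> real"
  assumes q: "sublinear q"
  shows "\<exists>q'. sublinear q' \<and> (\<forall>x. q' x \<le> q x) \<and> q' (- y) \<le> - q y"
proof -
  let ?g = "\<lambda>t x. q (x + t *\<^sub>R y) - t * q y"
  let ?Q = "\<lambda>x. INF t\<in>{0..}. ?g t x"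
  have b: "- q (- x) \<le> ?g t x" if "t \<ge> 0" for t x
    using sublinear_add[OF q, of "x + t *\<^sub>R y" "- x"] sublinear_scale[OF q that, of y] by simp
  have bdd: "bdd_below ((\<lambda>t. ?g t x) ` {0..})" for x
    by (rule bdd_belowI2[of _ "- q (- x)"]) (use b in auto)
  have lo: "?Q x \<le> ?g t x" if "t \<ge> 0" for t x
    by (rule cINF_lower[OF bdd]) (use that in auto)
  have "sublinear ?Q"
  proof (rule sublinear_INF[OF _ bdd])
    show "{0::real..} \<noteq> {}" by auto
    show "\<exists>j\<in>{0..}. ?g j (c *\<^sub>R x) \<le> c * ?g i x" if "i \<in> {0..}" "c > 0" for i c x
      using that sublinear_scale[OF q, of c "x + i *\<^sub>R y"]
      by (intro bexI[of _ "c * i"]) (auto simp: algebra_simps)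
    show "\<exists>k\<in>{0..}. ?g k (x + z) \<le> ?g i x + ?g j z" if "i \<in> {0..}" "j \<in> {0..}" for i j x z
      using that sublinear_add[OF q, of "x + i *\<^sub>R y" "z + j *\<^sub>R y"]
      by (intro bexI[of _ "i + j"]) (auto simp: algebra_simps)
    show "?g i 0 = 0" if "i \<in> {0..}" for i
      using that sublinear_scale[OF q, of i y] by simp
  qed
  moreover have "?Q x \<le> q x" for x using lo[of 0 x] by simp
  moreover have "?Q (- y) \<le> - q y" using lo[of 1 "- y"] sublinear_zero[OF q] by simp
  ultimately show ?thesis by blast
qed

lemma sublinear_dominates_linear:
  fixes p :: "'a::real_vector \<Rightarrow> real"
  assumes p: "sublinear p"
  shows "\<exists>f. linear f \<and> (\<forall>x. f x \<le> p x)"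
proof -
  let ?A = "{q. sublinear q \<and> (\<forall>x. q x \<le> p x)}"
  let ?P = "\<lambda>q r :: 'a \<Rightarrow> real. \<forall>x. r x \<le> q x"
  have "\<exists>m\<in>?A. \<forall>a\<in>?A. ?P m a \<longrightarrow> a = m"
  proof (rule predicate_Zorn)
    show "partial_order_on ?A (relation_of ?P ?A)"
      by (rule partial_order_on_relation_ofI) (auto intro: order_trans intro!: ext antisym)
    fix C assume C: "C \<in> Chains (relation_of ?P ?A)"
    then have CA: "C \<subseteq> ?A" by (auto simp: Chains_def relation_of_def)
    have tot: "?P q r \<or> ?P r q" if "q \<in> C" "r \<in> C" for q r
      using C that by (auto simp: Chains_def relation_of_def)
    show "\<exists>u\<in>?A. \<forall>a\<in>C. ?P a u"
    proof (cases "C = {}")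
      case True
      then show ?thesis using p by blast
    next
      case False
      have bdd: "bdd_below ((\<lambda>q. q x) ` C)" for x
      proof (rule bdd_belowI2[of _ "- p (- x)"])
        fix q assume "q \<in> C"
        then have "sublinear q" "q (- x) \<le> p (- x)" using CA by auto
        then show "- p (- x) \<le> q x" using sublinear_minus[of q x] by linarith
      qed
      let ?u = "\<lambda>x. INF q\<in>C. q x"
      have "sublinear ?u"
      proof (rule sublinear_INF[OF False bdd])
        show "\<exists>j\<in>C. j (c *\<^sub>R x) \<le> c * q x" if "q \<in> C" "c > 0" for q c x
          using that CA by (intro bexI[of _ q]) (auto simp: sublinear_scale)
        show "q 0 = 0" if "q \<in> C" for q
          using that CA sublinear_zero by auto
        show "\<exists>k\<in>C. k (x + y) \<le> q x + r y" if qr: "q \<in> C" "r \<in> C" for q r x y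
        proof -
          have s: "sublinear q" "sublinear r" using qr CA by auto
          show ?thesis
            using tot[OF qr]
          proof
            assume "?P q r"
            then have "r x \<le> q x" by blast
            then have "r (x + y) \<le> q x + r y" using sublinear_add[OF s(2), of x y] by linarith
            then show ?thesis using qr by blast
          next
            assume "?P r q"
            then have "q y \<le> r y" by blast
            then have "q (x + y) \<le> q x + r y" using sublinear_add[OF s(1), of x y] by linarith
            then show ?thesis using qr by blast
          qed
        qed
      qed
      moreover have lo: "?u x \<le> q x" if "q \<in> C" for q x
        by (rule cINF_lower[OF bdd that])
      moreover have "?u x \<le> p x" for x
      proof -
        obtain q where "q \<in> C" using False by blast
        then show ?thesis using lo[of q x] CA by (force intro: order_trans)
      qed
      ultimately show ?thesis by (intro bexI[of _ ?u]) auto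
    qed
  qed
  then obtain f where f: "sublinear f" "\<And>x. f x \<le> p x"
    and "\<forall>r\<in>?A. ?P f r \<longrightarrow> r = f"
    by blast
  then have min: "r = f" if "sublinear r" "\<And>x. r x \<le> f x" for r
    using that order_trans[OF that(2) f(2)] by simp
  have neg: "f (- y) = - f y" for y
  proof -
    obtain q where "sublinear q" "\<forall>x. q x \<le> f x" "q (- y) \<le> - f y"
      using sublinear_descend[OF f(1)] by blast
    then have "f (- y) \<le> - f y" using min[of q] by simp
    then show ?thesis using sublinear_minus[OF f(1), of y] by linarith
  qed
  have "linear f"
  proof (rule linearI)
    show "f (x + y) = f x + f y" for x y
      using sublinear_add[OF f(1), of x y] sublinear_add[OF f(1), of "- x" "- y"]
        neg[of x] neg[of y] neg[of "x + y"] by simp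
    show "f (c *\<^sub>R x) = c *\<^sub>R f x" for c x
      using sublinear_scale[OF f(1), of c x] sublinear_scale[OF f(1), of "- c" x]
        neg[of "c *\<^sub>R x"] by (cases "c \<ge> 0") auto
  qed
  with f(2) show ?thesis by blast
qed

lemma norming_functional:
  fixes x :: "'a::real_normed_vector"
  shows "\<exists>f :: 'a \<Rightarrow>\<^sub>L real. norm f \<le> 1 \<and> blinfun_apply f x = norm x"
proof -
  obtain p where p: "sublinear p" "\<And>z. p z \<le> norm z" "p (- x) \<le> - norm x"
    using sublinear_descend[OF sublinear_norm, of x] by blast
  obtain f where f: "linear f" "\<And>z. f z \<le> p z"
    using sublinear_dominates_linear[OF p(1)] by blast
  have le: "f z \<le> norm z" for z using f(2)[of z] p(2)[of z] by linarith
  have neg: "f (- z) = - f z" for z using f(1) by (rule linear_neg)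
  have ab: "\<bar>f z\<bar> \<le> norm z" for z using le[of z] le[of "- z"] neg[of z] by simp
  have bl: "bounded_linear f"
    by (rule bounded_linear_intro[where K = 1])
      (use f(1) ab in \<open>auto simp: linear_add linear_scale\<close>)
  have "norm (Blinfun f) \<le> 1"
    by (rule norm_blinfun_bound) (use ab bl in \<open>auto simp: bounded_linear_Blinfun_apply\<close>)
  moreover have "f x = norm x"
    using f(2)[of "- x"] p(3) neg[of x] le[of x] by simp
  ultimately show ?thesis
    using bl by (auto simp: bounded_linear_Blinfun_apply intro!: exI[of _ "Blinfun f"])
qed

lemma eq_zero_if_functionals_zero:
  fixes x :: "'a::real_normed_vector"
  assumes "\<And>f :: 'a \<Rightarrow>\<^sub>L real. blinfun_apply f x = 0"
  shows "x = 0"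
  using norming_functional[of x] assms by auto


section \<open>The algebraic tensor product\<close>

text \<open>A list \<open>[(x\<^sub>1, y\<^sub>1), \<dots>, (x\<^sub>n, y\<^sub>n)]\<close> stands for the formal sum
  \<open>x\<^sub>1 \<otimes> y\<^sub>1 + \<dots> + x\<^sub>n \<otimes> y\<^sub>n\<close> (scalars are absorbed into the \<open>x\<^sub>i\<close>).  Two formal sums
  denote the same tensor iff no bilinear form separates them.  The universal property of the
  resulting space is \<open>tensor_universal\<close> below.\<close>

definition eval_sum :: "('a \<Rightarrow> 'b \<Rightarrow> 'c::monoid_add) \<Rightarrow> ('a \<times> 'b) list \<Rightarrow> 'c" where
  "eval_sum A ps = (\<Sum>(x, y)\<leftarrow>ps. A x y)"

lemma eval_sum_simps [simp]:
  "eval_sum A [] = 0"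
  "eval_sum A (p # ps) = A (fst p) (snd p) + eval_sum A ps"
  "eval_sum A (ps @ qs) = eval_sum A ps + eval_sum A qs"
  by (simp_all add: eval_sum_def case_prod_beta)

definition tensor_eq :: "('a::real_vector \<times> 'b::real_vector) list \<Rightarrow> ('a \<times> 'b) list \<Rightarrow> bool" where
  "tensor_eq ps qs \<longleftrightarrow>
     (\<forall>A :: 'a \<Rightarrow> 'b \<Rightarrow> real. bilinear A \<longrightarrow> eval_sum A ps = eval_sum A qs)"

quotient_type (overloaded) ('a, 'b) tensor =
  "('a::real_vector \<times> 'b::real_vector) list" / tensor_eq
  by (rule equivpI) (auto simp: reflp_def symp_def transp_def tensor_eq_def)

definition scale_sum :: "real \<Rightarrow> ('a::real_vector \<times> 'b) list \<Rightarrow> ('a \<times> 'b) list" where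
  "scale_sum c = map (\<lambda>(x, y). (c *\<^sub>R x, y))"

lemma eval_scale_sum:
  "bilinear A \<Longrightarrow> eval_sum A (scale_sum c ps) = c *\<^sub>R eval_sum A ps"
  by (induction ps) (auto simp: scale_sum_def bilinear_lmul scaleR_add_right)

instantiation tensor :: (real_vector, real_vector) real_vector
begin

lift_definition zero_tensor :: "('a, 'b) tensor" is "[]" .

lift_definition plus_tensor :: "('a, 'b) tensor \<Rightarrow> ('a, 'b) tensor \<Rightarrow> ('a, 'b) tensor" is "(@)"
  by (simp add: tensor_eq_def)

lift_definition scaleR_tensor :: "real \<Rightarrow> ('a, 'b) tensor \<Rightarrow> ('a, 'b) tensor" is scale_sum
  by (simp add: tensor_eq_def eval_scale_sum)

definition uminus_tensor :: "('a, 'b) tensor \<Rightarrow> ('a, 'b) tensor" where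
  "uminus_tensor u = (- 1) *\<^sub>R u"

definition minus_tensor :: "('a, 'b) tensor \<Rightarrow> ('a, 'b) tensor \<Rightarrow> ('a, 'b) tensor" where
  "minus_tensor u v = u + - v"

instance
proof
  fix u v w :: "('a, 'b) tensor" and a b :: real
  show "u + v + w = u + (v + w)" by transfer (simp add: tensor_eq_def)
  show "u + v = v + u" by transfer (simp add: tensor_eq_def)
  show "0 + u = u" by transfer (simp add: tensor_eq_def)
  show "- u + u = 0"
    unfolding uminus_tensor_def by transfer (simp add: tensor_eq_def eval_scale_sum)
  show "u - v = u + - v" by (rule minus_tensor_def)
  show "a *\<^sub>R (u + v) = a *\<^sub>R u + a *\<^sub>R v"
    by transfer (simp add: tensor_eq_def eval_scale_sum algebra_simps)
  show "(a + b) *\<^sub>R u = a *\<^sub>R u + b *\<^sub>R u"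
    by transfer (simp add: tensor_eq_def eval_scale_sum algebra_simps)
  show "a *\<^sub>R b *\<^sub>R u = (a * b) *\<^sub>R u"
    by transfer (simp add: tensor_eq_def eval_scale_sum)
  show "1 *\<^sub>R u = u"
    by transfer (simp add: tensor_eq_def eval_scale_sum)
qed

end

lift_definition tensor :: "'a::real_vector \<Rightarrow> 'b::real_vector \<Rightarrow> ('a, 'b) tensor" (infixr \<open>\<otimes>\<close> 75)
  is "\<lambda>x y. [(x, y)]" .

lemma bilinear_tensor: "bilinear (tensor :: 'a::real_vector \<Rightarrow> 'b::real_vector \<Rightarrow> _)"
  unfolding bilinear_def
  by (intro conjI allI linearI; transfer)
    (auto simp: tensor_eq_def scale_sum_def bilinear_ladd bilinear_radd bilinear_lmul bilinear_rmul)

lemma abs_tensor_eq_eval_sum: "abs_tensor ps = eval_sum tensor ps"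
proof (induction ps)
  case Nil
  then show ?case by (simp add: zero_tensor.abs_eq)
next
  case (Cons p ps)
  have "abs_tensor (p # ps) = abs_tensor [p] + abs_tensor ps"
    by (simp add: plus_tensor.abs_eq)
  then show ?case by (simp add: Cons tensor.abs_eq)
qed

lemma tensor_representation: "\<exists>ps. u = eval_sum tensor ps"
  by (metis abs_tensor_eq_eval_sum Quotient_tensor Quotient_abs_rep)

lemma eval_sum_linear: "linear L \<Longrightarrow> L (eval_sum A ps) = eval_sum (\<lambda>x y. L (A x y)) ps"
  by (induction ps) (auto simp: linear_0 linear_add)

lemma eval_sum_tensor_eq_iff: "eval_sum tensor ps = eval_sum tensor qs \<longleftrightarrow> tensor_eq ps qs"
  by (metis abs_tensor_eq_eval_sum tensor.abs_eq_iff)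

lemma linear_form_separates:
  fixes z :: "'c::real_vector"
  assumes "z \<noteq> 0"
  shows "\<exists>g :: 'c \<Rightarrow> real. linear g \<and> g z \<noteq> 0"
proof -
  have "independent {z}" using assms by simp
  then obtain g :: "'c \<Rightarrow> real" where "linear g" "g z = 1"
    using linear_independent_extend[of "{z}" "\<lambda>_. 1 :: real"] by auto
  then show ?thesis by auto
qed

lemma bilinear_compose_linear: "linear g \<Longrightarrow> bilinear A \<Longrightarrow> bilinear (\<lambda>x y. g (A x y))"
  unfolding bilinear_def by (auto intro: linear_compose[unfolded o_def])

lemma tensor_eq_bilinear:
  fixes A :: "'a::real_vector \<Rightarrow> 'b::real_vector \<Rightarrow> 'c::real_vector"
  assumes A: "bilinear A" and eq: "tensor_eq ps qs"
  shows "eval_sum A ps = eval_sum A qs"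
proof (rule ccontr)
  assume "eval_sum A ps \<noteq> eval_sum A qs"
  then obtain g :: "'c \<Rightarrow> real" where g: "linear g" "g (eval_sum A ps - eval_sum A qs) \<noteq> 0"
    using linear_form_separates[of "eval_sum A ps - eval_sum A qs"] by auto
  have "eval_sum (\<lambda>x y. g (A x y)) ps = eval_sum (\<lambda>x y. g (A x y)) qs"
    using eq bilinear_compose_linear[OF g(1) A] by (simp add: tensor_eq_def)
  then show False
    using g by (simp add: linear_diff eval_sum_linear)
qed

theorem tensor_universal:
  fixes A :: "'a::real_vector \<Rightarrow> 'b::real_vector \<Rightarrow> 'c::real_vector"
  assumes A: "bilinear A"
  shows "\<exists>!L :: ('a, 'b) tensor \<Rightarrow> 'c. linear L \<and> (\<forall>x y. L (x \<otimes> y) = A x y)"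
proof -
  define L where "L u = eval_sum A (rep_tensor u)" for u
  have L: "L (abs_tensor ps) = eval_sum A ps" for ps
  proof -
    have "tensor_eq (rep_tensor (abs_tensor ps)) ps"
      using Quotient_tensor by (metis Quotient_abs_rep tensor.abs_eq_iff)
    then show ?thesis unfolding L_def by (rule tensor_eq_bilinear[OF A])
  qed
  have "linear L"
  proof (rule linearI)
    show "L (u + v) = L u + L v" for u v
      by (induction u rule: tensor.abs_induct; induction v rule: tensor.abs_induct)
        (simp add: plus_tensor.abs_eq L)
    show "L (c *\<^sub>R u) = c *\<^sub>R L u" for c u
      by (induction u rule: tensor.abs_induct) (simp add: scaleR_tensor.abs_eq L eval_scale_sum[OF A])
  qed
  moreover have "L (x \<otimes> y) = A x y" for x y
    by (simp add: tensor.abs_eq L)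
  moreover have "M = L" if M: "linear M" "\<forall>x y. M (x \<otimes> y) = A x y"
    for M :: "('a, 'b) tensor \<Rightarrow> 'c"
  proof
    fix u :: "('a, 'b) tensor"
    obtain ps where "u = eval_sum tensor ps" using tensor_representation by blast
    then show "M u = L u"
      using M \<open>linear L\<close> \<open>\<And>x y. L (x \<otimes> y) = A x y\<close> by (simp add: eval_sum_linear)
  qed
  ultimately show ?thesis by blast
qed


section \<open>The projective norm\<close>

lemma eval_sum_norm_nonneg: "0 \<le> eval_sum (\<lambda>x y. norm x * norm y) ps"
  by (induction ps) auto

lemma eval_scale_sum_norm:
  "eval_sum (\<lambda>x y. norm x * norm y) (scale_sum c ps)
     = \<bar>c\<bar> * eval_sum (\<lambda>x y. norm x * norm y) ps"
  by (induction ps) (auto simp: scale_sum_def algebra_simps)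

lemma eval_sum_functionals_bound:
  fixes f :: "'a::real_normed_vector \<Rightarrow>\<^sub>L real" and g :: "'b::real_normed_vector \<Rightarrow>\<^sub>L real"
  shows "\<bar>eval_sum (\<lambda>x y. blinfun_apply f x * blinfun_apply g y) ps\<bar> \<le> norm f * norm g * eval_sum (\<lambda>x y. norm x * norm y) ps"
proof (induction ps)
  case (Cons p ps)
  have "\<bar>blinfun_apply f (fst p) * blinfun_apply g (snd p)\<bar> \<le> (norm f * norm (fst p)) * (norm g * norm (snd p))"
    unfolding abs_mult using norm_blinfun[of f "fst p"] norm_blinfun[of g "snd p"]
    by (intro mult_mono) auto
  with Cons show ?case by (simp add: algebra_simps)
qed simp

lemma bilinear_mult_functionals: 
  "linear f \<Longrightarrow> linear g \<Longrightarrow> bilinear (\<lambda>x y. f x * g y :: real)"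
  unfolding bilinear_def by (auto intro!: linearI simp: linear_add linear_scale algebra_simps)

lemma tensor_eq_Nil_if_functionals_zero:
  fixes ps :: "('a::real_normed_vector \<times> 'b::real_normed_vector) list"
  assumes z: "\<And>(f :: 'a \<Rightarrow>\<^sub>L real) (g :: 'b \<Rightarrow>\<^sub>L real). eval_sum (\<lambda>x y. blinfun_apply f x * blinfun_apply g y) ps = 0"
  shows "tensor_eq ps []"
proof -
  have 1: "eval_sum (\<lambda>x y. blinfun_apply g y *\<^sub>R x) ps = 0" for g :: "'b \<Rightarrow>\<^sub>L real"
  proof (rule eq_zero_if_functionals_zero)
    fix f :: "'a \<Rightarrow>\<^sub>L real"
    have "blinfun_apply f (eval_sum (\<lambda>x y. blinfun_apply g y *\<^sub>R x) ps) = eval_sum (\<lambda>x y. blinfun_apply f (blinfun_apply g y *\<^sub>R x)) ps"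
      by (rule eval_sum_linear) (simp add: blinfun.bounded_linear_right bounded_linear.linear)
    then show "blinfun_apply f (eval_sum (\<lambda>x y. blinfun_apply g y *\<^sub>R x) ps) = 0"
      using z[of f g] by (simp add: blinfun.scaleR_right mult.commute)
  qed
  have 2: "eval_sum (\<lambda>x y. h x *\<^sub>R y) ps = 0" if h: "linear h" for h :: "'a \<Rightarrow> real"
  proof (rule eq_zero_if_functionals_zero)
    fix g :: "'b \<Rightarrow>\<^sub>L real"
    have "blinfun_apply g (eval_sum (\<lambda>x y. h x *\<^sub>R y) ps) = eval_sum (\<lambda>x y. blinfun_apply g (h x *\<^sub>R y)) ps"
      by (rule eval_sum_linear) (simp add: blinfun.bounded_linear_right bounded_linear.linear)
    also have "\<dots> = eval_sum (\<lambda>x y. h (blinfun_apply g y *\<^sub>R x)) ps"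
      using h by (simp add: blinfun.scaleR_right linear_scale mult.commute)
    also have "\<dots> = h (eval_sum (\<lambda>x y. blinfun_apply g y *\<^sub>R x) ps)"
      by (rule eval_sum_linear[OF h, symmetric])
    finally show "blinfun_apply g (eval_sum (\<lambda>x y. h x *\<^sub>R y) ps) = 0"
      using 1 h by (simp add: linear_0)
  qed
  have "eval_sum A ps = 0" if A: "bilinear A" for A :: "'a \<Rightarrow> 'b \<Rightarrow> real"
  proof -
    obtain B where B: "B \<subseteq> fst ` set ps" "independent B" "fst ` set ps \<subseteq> span B"
      using maximal_independent_subset[of "fst ` set ps"] by blast
    have fin: "finite B" using B(1) finite_subset by blast
    have "\<exists>h :: 'a \<Rightarrow> real. linear h \<and> (\<forall>b'\<in>B. h b' = (if b' = b then 1 else 0))" for b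
      using linear_independent_extend[OF B(2), of "\<lambda>b'. if b' = b then 1 else 0 :: real"] by blast
    then obtain h :: "'a \<Rightarrow> 'a \<Rightarrow> real" where h: "\<And>b. linear (h b)"
      and hB: "\<And>b b'. b' \<in> B \<Longrightarrow> h b b' = (if b' = b then 1 else 0)"
      by metis
    have lin: "linear (\<lambda>x. \<Sum>b\<in>B. h b x *\<^sub>R b)"
      by (rule linearI) (simp_all add: h linear_add linear_scale scaleR_add_left sum.distrib scaleR_sum_right)
    have exp: "x = (\<Sum>b\<in>B. h b x *\<^sub>R b)" if "x \<in> span B" for x
    proof -
      have "id x = (\<Sum>b\<in>B. h b x *\<^sub>R b)"
      proof (rule linear_eq_on_span[OF _ lin _ that])
        show "linear (id :: 'a \<Rightarrow> 'a)" by (rule linear_id)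
        fix b' assume "b' \<in> B"
        then show "id b' = (\<Sum>b\<in>B. h b b' *\<^sub>R b)"
          using fin by (simp add: hB if_distrib[of "\<lambda>c. c *\<^sub>R _"] cong: if_cong)
      qed
      then show ?thesis by simp
    qed
    have "eval_sum A qs = (\<Sum>b\<in>B. A b (eval_sum (\<lambda>x y. h b x *\<^sub>R y) qs))"
      if "set qs \<subseteq> set ps" for qs
      using that
    proof (induction qs)
      case Nil
      then show ?case using A by (simp add: bilinear_rzero)
    next
      case (Cons p qs)
      have "fst p \<in> span B" using Cons.prems B(3) by auto
      have "linear (\<lambda>x. A x (snd p))" using A by (simp add: bilinear_def)
      then have "A (\<Sum>b\<in>B. h b (fst p) *\<^sub>R b) (snd p) = (\<Sum>b\<in>B. A (h b (fst p) *\<^sub>R b) (snd p))"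
        by (rule linear_sum)
      then have "A (fst p) (snd p) = (\<Sum>b\<in>B. A b (h b (fst p) *\<^sub>R snd p))"
        using exp[OF \<open>fst p \<in> span B\<close>] A by (simp add: bilinear_lmul bilinear_rmul)
      then show ?case
        using Cons A by (simp add: bilinear_radd sum.distrib)
    qed
    from this[of ps] show ?thesis using 2[OF h] A by (simp add: bilinear_rzero)
  qed
  then show ?thesis by (simp add: tensor_eq_def)
qed

instantiation tensor :: (real_normed_vector, real_normed_vector) real_normed_vector
begin

definition norm_tensor :: "('a, 'b) tensor \<Rightarrow> real" where
  "norm_tensor u = Inf {(\<Sum>(x, y)\<leftarrow>ps. norm x * norm y) | ps. u = (\<Sum>(x, y)\<leftarrow>ps. x \<otimes> y)}"

definition dist_tensor :: "('a, 'b) tensor \<Rightarrow> ('a, 'b) tensor \<Rightarrow> real" where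
  "dist_tensor u v = norm (u - v)"

definition sgn_tensor :: "('a, 'b) tensor \<Rightarrow> ('a, 'b) tensor" where
  "sgn_tensor u = u /\<^sub>R norm u"

definition uniformity_tensor :: "(('a, 'b) tensor \<times> ('a, 'b) tensor) filter" where
  "uniformity_tensor = (INF e\<in>{0 <..}. principal {(u, v). dist u v < e})"

definition open_tensor :: "('a, 'b) tensor set \<Rightarrow> bool" where
  "open_tensor S \<longleftrightarrow> (\<forall>u\<in>S. \<forall>\<^sub>F (u', v) in uniformity. u' = u \<longrightarrow> v \<in> S)"

instance
proof
  let ?N = "eval_sum (\<lambda>(x :: 'a) (y :: 'b). norm x * norm y)"
  have nd: "norm u = Inf {?N ps | ps. u = eval_sum tensor ps}" for u :: "('a, 'b) tensor"
    by (simp add: norm_tensor_def eval_sum_def)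
  have lo: "norm u \<le> ?N ps" if "u = eval_sum tensor ps" for ps and u :: "('a, 'b) tensor"
    unfolding nd by (rule cInf_lower) (use that eval_sum_norm_nonneg in \<open>auto intro!: bdd_belowI[of _ 0]\<close>)
  have gr: "c \<le> norm u" if "\<And>ps. u = eval_sum tensor ps \<Longrightarrow> c \<le> ?N ps"
    for c and u :: "('a, 'b) tensor"
    unfolding nd by (rule cInf_greatest) (use that tensor_representation[of u] in auto)
  have nonneg: "0 \<le> norm u" for u :: "('a, 'b) tensor"
    by (rule gr) (rule eval_sum_norm_nonneg)
  have n0: "norm (0 :: ('a, 'b) tensor) = 0"
    using lo[of 0 "[]"] nonneg[of 0] by simp
  have sc: "scaleR c (eval_sum tensor ps) = eval_sum tensor (scale_sum c ps)"
    for c and ps :: "('a \<times> 'b) list"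
    by (simp add: eval_scale_sum[OF bilinear_tensor])
  have sle: "norm (c *\<^sub>R u) \<le> \<bar>c\<bar> * norm u" if c: "c \<noteq> 0" for c and u :: "('a, 'b) tensor"
  proof -
    have "norm (c *\<^sub>R u) / \<bar>c\<bar> \<le> norm u"
    proof (rule gr)
      fix ps assume "u = eval_sum tensor ps"
      then have "norm (c *\<^sub>R u) \<le> \<bar>c\<bar> * ?N ps"
        using lo[of "c *\<^sub>R u" "scale_sum c ps"] by (simp add: sc eval_scale_sum_norm)
      then show "norm (c *\<^sub>R u) / \<bar>c\<bar> \<le> ?N ps" using c by (simp add: field_simps)
    qed
    then show ?thesis using c by (simp add: field_simps)
  qed
  fix u v :: "('a, 'b) tensor" and c :: real
  show "dist u v = norm (u - v)" by (rule dist_tensor_def)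
  show "sgn u = u /\<^sub>R norm u" by (rule sgn_tensor_def)
  show "(uniformity :: (('a, 'b) tensor \<times> ('a, 'b) tensor) filter)
      = (INF e\<in>{0 <..}. principal {(u, v). dist u v < e})"
    by (rule uniformity_tensor_def)
  show "open S \<longleftrightarrow> (\<forall>u\<in>S. \<forall>\<^sub>F (u', v) in uniformity. u' = u \<longrightarrow> v \<in> S)"
    for S :: "('a, 'b) tensor set"
    by (rule open_tensor_def)
  show "norm (c *\<^sub>R u) = \<bar>c\<bar> * norm u"
  proof (cases "c = 0")
    case True
    then show ?thesis by (simp add: n0)
  next
    case False
    have "norm (inverse c *\<^sub>R (c *\<^sub>R u)) \<le> \<bar>inverse c\<bar> * norm (c *\<^sub>R u)"
      by (rule sle) (use False in simp)
    then have "\<bar>c\<bar> * norm u \<le> norm (c *\<^sub>R u)" using False by (simp add: field_simps)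
    then show ?thesis using sle[OF False, of u] by linarith
  qed
  show "norm (u + v) \<le> norm u + norm v"
  proof -
    have "norm (u + v) - norm v \<le> norm u"
    proof (rule gr)
      fix ps assume ps: "u = eval_sum tensor ps"
      have "norm (u + v) - ?N ps \<le> norm v"
      proof (rule gr)
        fix qs assume "v = eval_sum tensor qs"
        then show "norm (u + v) - ?N ps \<le> ?N qs"
          using lo[of "u + v" "ps @ qs"] ps by simp
      qed
      then show "norm (u + v) - norm v \<le> ?N ps" by linarith
    qed
    then show ?thesis by linarith
  qed
  show "norm u = 0 \<longleftrightarrow> u = 0"
  proof
    assume u0: "norm u = 0"
    obtain ps where ps: "u = eval_sum tensor ps" using tensor_representation by blast
    have "tensor_eq ps []"
    proof (rule tensor_eq_Nil_if_functionals_zero)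
      fix f :: "'a \<Rightarrow>\<^sub>L real" and g :: "'b \<Rightarrow>\<^sub>L real"
      let ?s = "eval_sum (\<lambda>x y. blinfun_apply f x * blinfun_apply g y)"
      have bil: "bilinear (\<lambda>x y. blinfun_apply f x * blinfun_apply g y)"
        by (intro bilinear_mult_functionals bounded_linear.linear blinfun.bounded_linear_right)
      define K where "K = norm f * norm g + 1"
      have K: "K > 0" unfolding K_def by (simp add: add_nonneg_pos)
      have "\<bar>?s ps\<bar> / K \<le> norm u"
      proof (rule gr)
        fix qs assume "u = eval_sum tensor qs"
        then have "tensor_eq ps qs" using ps by (simp add: eval_sum_tensor_eq_iff)
        then have "?s ps = ?s qs" using bil by (simp add: tensor_eq_def)
        then have "\<bar>?s ps\<bar> \<le> norm f * norm g * ?N qs"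
          using eval_sum_functionals_bound[of f g qs] by simp
        also have "\<dots> \<le> K * ?N qs"
          unfolding K_def by (intro mult_right_mono eval_sum_norm_nonneg) simp
        finally show "\<bar>?s ps\<bar> / K \<le> ?N qs" using K by (simp add: field_simps)
      qed
      then show "?s ps = 0" using u0 K by (simp add: field_simps)
    qed
    then show "u = 0"
      using eval_sum_tensor_eq_iff[of ps "[]"] ps by simp
  qed (simp add: n0)
qed

end


section \<open>Completion of a normed space\<close>

text \<open>The completion is realised as the closure of the canonical image in the bidual.\<close>

lift_definition bidual_embed :: "'a::real_normed_vector \<Rightarrow> ('a \<Rightarrow>\<^sub>L real) \<Rightarrow>\<^sub>L real"
  is "\<lambda>x f. blinfun_apply f x"
  by (rule blinfun.bounded_linear_left)

lemma linear_bidual_embed: "linear bidual_embed"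
  by (intro linearI blinfun_eqI)
    (simp_all add: bidual_embed.rep_eq plus_blinfun.rep_eq scaleR_blinfun.rep_eq
      blinfun.add_right blinfun.scaleR_right)

lemma norm_bidual_embed: "norm (bidual_embed x) = norm x"
proof (rule antisym)
  show "norm (bidual_embed x) \<le> norm x"
  proof (rule norm_blinfun_bound)
    show "norm (blinfun_apply (bidual_embed x) f) \<le> norm x * norm f" for f
      using norm_blinfun[of f x] by (simp add: bidual_embed.rep_eq mult.commute)
  qed simp
  obtain f :: "'a \<Rightarrow>\<^sub>L real" where f: "norm f \<le> 1" "blinfun_apply f x = norm x"
    using norming_functional by blast
  have "norm x \<le> norm (bidual_embed x) * norm f"
    using norm_blinfun[of "bidual_embed x" f] f(2) by (simp add: bidual_embed.rep_eq)
  also have "\<dots> \<le> norm (bidual_embed x)"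
    using mult_left_mono[OF f(1), of "norm (bidual_embed x)"] by simp
  finally show "norm x \<le> norm (bidual_embed x)" .
qed

lemma bidual_embed_in_closure: "bidual_embed x \<in> closure (range bidual_embed)"
  by (rule subsetD[OF closure_subset rangeI])

typedef (overloaded) 'a completion =
  "closure (range (bidual_embed :: 'a::real_normed_vector \<Rightarrow> ('a \<Rightarrow>\<^sub>L real) \<Rightarrow>\<^sub>L real))"
  by (rule exI, rule bidual_embed_in_closure)

setup_lifting type_definition_completion

lemma range_bidual_embed_closed:
  assumes "u \<in> closure (range bidual_embed)" "v \<in> closure (range bidual_embed)"
  shows "u + v \<in> closure (range bidual_embed)" "c *\<^sub>R u \<in> closure (range bidual_embed)"
proof -
  obtain x where x: "x \<longlonglongrightarrow> u" "\<And>n. x n \<in> range bidual_embed"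
    using assms(1) closure_sequential by blast
  obtain y where y: "y \<longlonglongrightarrow> v" "\<And>n. y n \<in> range bidual_embed"
    using assms(2) closure_sequential by blast
  have sub: "subspace (range (bidual_embed :: 'a \<Rightarrow> _))"
    by (rule linear_subspace_image[OF linear_bidual_embed subspace_UNIV])
  have "(\<lambda>n. x n + y n) \<longlonglongrightarrow> u + v" by (intro tendsto_intros x y)
  moreover have "x n + y n \<in> range bidual_embed" for n
    using subspace_add[OF sub x(2) y(2)] .
  ultimately show "u + v \<in> closure (range bidual_embed)"
    unfolding closure_sequential by (intro exI[of _ "\<lambda>n. x n + y n"]) auto
  have "(\<lambda>n. c *\<^sub>R x n) \<longlonglongrightarrow> c *\<^sub>R u" by (intro tendsto_intros x)
  moreover have "c *\<^sub>R x n \<in> range bidual_embed" for n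
    using subspace_scale[OF sub x(2)] .
  ultimately show "c *\<^sub>R u \<in> closure (range bidual_embed)"
    unfolding closure_sequential by (intro exI[of _ "\<lambda>n. c *\<^sub>R x n"]) auto
qed

instantiation completion :: (real_normed_vector) real_normed_vector
begin

lift_definition zero_completion :: "'a completion" is 0
  using bidual_embed_in_closure[of 0] by (simp add: linear_0[OF linear_bidual_embed])

lift_definition plus_completion :: "'a completion \<Rightarrow> 'a completion \<Rightarrow> 'a completion" is "(+)"
  by (rule range_bidual_embed_closed)

lift_definition scaleR_completion :: "real \<Rightarrow> 'a completion \<Rightarrow> 'a completion" is "(*\<^sub>R)"
  by (rule range_bidual_embed_closed)

lift_definition uminus_completion :: "'a completion \<Rightarrow> 'a completion" is uminus
  using range_bidual_embed_closed(2)[of _ _ "- 1"] by simp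

lift_definition minus_completion :: "'a completion \<Rightarrow> 'a completion \<Rightarrow> 'a completion" is "(-)"
proof -
  fix u v :: "('a \<Rightarrow>\<^sub>L real) \<Rightarrow>\<^sub>L real"
  assume "u \<in> closure (range bidual_embed)" "v \<in> closure (range bidual_embed)"
  then have "u + (- 1) *\<^sub>R v \<in> closure (range bidual_embed)"
    by (intro range_bidual_embed_closed)
  then show "u - v \<in> closure (range bidual_embed)" by simp
qed

lift_definition norm_completion :: "'a completion \<Rightarrow> real" is norm .

definition dist_completion :: "'a completion \<Rightarrow> 'a completion \<Rightarrow> real" where
  "dist_completion u v = norm (u - v)"

definition sgn_completion :: "'a completion \<Rightarrow> 'a completion" where
  "sgn_completion u = scaleR (inverse (norm u)) u"

definition uniformity_completion :: "('a completion \<times> 'a completion) filter" where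
  "uniformity_completion = (INF e\<in>{0 <..}. principal {(u, v). dist u v < e})"

definition open_completion :: "'a completion set \<Rightarrow> bool" where
  "open_completion S \<longleftrightarrow> (\<forall>u\<in>S. \<forall>\<^sub>F (u', v) in uniformity. u' = u \<longrightarrow> v \<in> S)"

instance
proof
  fix u v w :: "'a completion" and a b :: real
  show "u + v + w = u + (v + w)" by transfer (rule add.assoc)
  show "u + v = v + u" by transfer (rule add.commute)
  show "0 + u = u" by transfer (rule add_0)
  show "- u + u = 0" by transfer (rule left_minus)
  show "u - v = u + - v" by transfer (rule diff_conv_add_uminus)
  show "a *\<^sub>R (u + v) = a *\<^sub>R u + a *\<^sub>R v" by transfer (rule scaleR_add_right)
  show "(a + b) *\<^sub>R u = a *\<^sub>R u + b *\<^sub>R u" by transfer (rule scaleR_add_left)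
  show "a *\<^sub>R b *\<^sub>R u = (a * b) *\<^sub>R u" by transfer (rule scaleR_scaleR)
  show "1 *\<^sub>R u = u" by transfer (rule scaleR_one)
  show "norm u = 0 \<longleftrightarrow> u = 0" by transfer (rule norm_eq_zero)
  show "norm (u + v) \<le> norm u + norm v" by transfer (rule norm_triangle_ineq)
  show "norm (a *\<^sub>R u) = \<bar>a\<bar> * norm u" by transfer (rule norm_scaleR)
qed (rule dist_completion_def sgn_completion_def uniformity_completion_def open_completion_def)+

end

lemma dist_Rep_completion: "dist (Rep_completion u) (Rep_completion v) = dist u v"
  by (simp add: dist_norm norm_completion.rep_eq minus_completion.rep_eq)

instance completion :: (real_normed_vector) banach
proof
  fix X :: "nat \<Rightarrow> 'a completion"
  assume "Cauchy X"
  then have "Cauchy (\<lambda>n. Rep_completion (X n))"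
    by (simp add: Cauchy_def dist_Rep_completion)
  then obtain l where l: "(\<lambda>n. Rep_completion (X n)) \<longlonglongrightarrow> l"
    using Cauchy_convergent convergent_def by blast
  have "l \<in> closure (range bidual_embed)"
    by (rule closed_sequentially[OF closed_closure _ l]) (rule Rep_completion)
  then obtain u where "l = Rep_completion u"
    using Rep_completion_cases by blast
  with l have "X \<longlonglongrightarrow> u"
    by (simp add: lim_sequentially dist_Rep_completion)
  then show "convergent X" by (auto simp: convergent_def)
qed

lift_definition to_completion :: "'a::real_normed_vector \<Rightarrow> 'a completion" is bidual_embed
  by (rule bidual_embed_in_closure)

lemma linear_to_completion: "linear to_completion"
  by (intro linearI; transfer) (auto simp: linear_add linear_scale linear_bidual_embed)

lemma norm_to_completion: "norm (to_completion x) = norm x"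
  by transfer (rule norm_bidual_embed)

lemma dense_to_completion: "closure (range to_completion) = UNIV"
proof -
  have "u \<in> closure (range to_completion)" for u :: "'a completion"
    unfolding closure_approachable
  proof (intro allI impI)
    fix e :: real assume "e > 0"
    then obtain x where "dist (bidual_embed x) (Rep_completion u) < e"
      using Rep_completion[of u] unfolding closure_approachable by blast
    then show "\<exists>v\<in>range to_completion. dist v u < e"
      by (auto simp: to_completion.rep_eq simp flip: dist_Rep_completion)
  qed
  then show ?thesis by blast
qed


section \<open>The projective tensor product and the property SD2P\<close>

type_synonym ('a, 'b) projective_tensor = "('a, 'b) tensor completion"

definition infinite_dimensional :: "'a::real_vector itself \<Rightarrow> bool" where
  "infinite_dimensional _ \<longleftrightarrow> \<not> (\<exists>B :: 'a set. finite B \<and> span B = UNIV)"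

definition norms_by :: "real \<Rightarrow> 'a::real_normed_vector set \<Rightarrow> ('a \<Rightarrow>\<^sub>L real) set \<Rightarrow> bool" where
  "norms_by l B A \<longleftrightarrow> (\<forall>f\<in>A. \<exists>x\<in>B - {0}. blinfun_apply f x \<ge> l * norm f * norm x)"

text \<open>The cardinal \<open>\<kappa>\<close> is a well-order on an arbitrary type, not tied to the space.\<close>

definition SD2P_less :: "'k rel \<Rightarrow> 'a::real_normed_vector itself \<Rightarrow> bool" where
  "SD2P_less \<kappa> _ \<longleftrightarrow>
     (\<forall>A \<subseteq> sphere (0 :: 'a \<Rightarrow>\<^sub>L real) 1. |A| <o \<kappa> \<longrightarrow>
       (\<forall>l\<in>{0<..<1}. \<exists>B \<subseteq> sphere (0 :: 'a) 1. \<exists>f \<in> sphere (0 :: 'a \<Rightarrow>\<^sub>L real) 1.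
          norms_by l B A \<and> (\<forall>x\<in>B. blinfun_apply f x \<ge> l)))"

end

theory Submission
  imports Defs
begin

text \<open>Through \<open>(x, y) \<mapsto> x \<otimes> y\<close>, norm-one functionals on the projective tensor product are
  norm-one bounded bilinear forms, and such a form is almost normed by a single elementary
  tensor (\<open>functional_almost_normed_by_elementary\<close>).  This is what distinguishes the projective
  norm: its unit ball is the closed convex hull of the elementary tensors of unit vectors.

  Given a small family of forms \<open>G\<close> and \<open>x\<^sub>G \<otimes> y\<^sub>G\<close> almost norming \<open>G\<close>, one replaces the two
  coordinates one after the other.  The functionals \<open>G (\<sqdot> \<otimes> y\<^sub>G)\<close> form a family of the same size
  on the first factor, so its SD2P yields a single functional \<open>f\<close> and unit vectors \<open>x'\<^sub>G\<close>, all
  nearly normed by \<open>f\<close>, with \<open>G (x'\<^sub>G \<otimes> y\<^sub>G)\<close> still close to one.  The functionals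
  \<open>G (x'\<^sub>G \<otimes> \<sqdot>)\<close> then have norm close to one on the second factor, whose SD2P yields \<open>g\<close> and
  \<open>y'\<^sub>G\<close> in the same way.  The vectors \<open>x'\<^sub>G \<otimes> y'\<^sub>G\<close> norm the family, and \<open>f \<otimes> g\<close>, which has
  norm one, is large at all of them.  Three approximations are made on the way, so each is
  carried out with the cube root of the required constant.\<close>

section \<open>Elementary tensors and the projective norm\<close>

lemma norm_eval_sum_tensor_le:
  "norm (eval_sum tensor ps) \<le> eval_sum (\<lambda>x y. norm x * norm y) ps"
  unfolding norm_tensor_def
  by (rule cInf_lower)
    (use eval_sum_norm_nonneg in \<open>auto simp: eval_sum_def intro!: bdd_belowI[of _ 0]\<close>)

lemma norm_tensor_greatest:
  assumes "\<And>ps. u = eval_sum tensor ps \<Longrightarrow> c \<le> eval_sum (\<lambda>x y. norm x * norm y) ps"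
  shows "c \<le> norm u"
  unfolding norm_tensor_def
  by (rule cInf_greatest)
    (use assms tensor_representation[of u] in \<open>auto simp: eval_sum_def\<close>)

lemma abs_eval_sum_le:
  fixes A :: "'a::real_normed_vector \<Rightarrow> 'b::real_normed_vector \<Rightarrow> real"
  assumes "\<And>x y. \<bar>A x y\<bar> \<le> C * (norm x * norm y)"
  shows "\<bar>eval_sum A ps\<bar> \<le> C * eval_sum (\<lambda>x y. norm x * norm y) ps"
proof (induction ps)
  case (Cons p ps)
  then show ?case
    using assms[of "fst p" "snd p"] by (simp add: algebra_simps)
qed simp

text \<open>Since the projective norm is the infimum of \<open>\<Sum> \<parallel>x\<^sub>i\<parallel> \<parallel>y\<^sub>i\<parallel>\<close> over all representations, a bound
  on elementary tensors passes to all tensors with the same constant.\<close>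

lemma linear_form_bound_from_elementary:
  fixes L :: "('a::real_normed_vector, 'b::real_normed_vector) tensor \<Rightarrow> real"
  assumes L: "linear L" and C: "C \<ge> 0"
    and bound: "\<And>x y. \<bar>L (x \<otimes> y)\<bar> \<le> C * (norm x * norm y)"
  shows "\<bar>L u\<bar> \<le> C * norm u"
proof (cases "C = 0")
  case True
  obtain ps where "u = eval_sum tensor ps" using tensor_representation by blast
  then show ?thesis
    using abs_eval_sum_le[of "\<lambda>x y. L (x \<otimes> y)" C ps] bound True
    by (simp add: eval_sum_linear[OF L])
next
  case False
  with C have C: "C > 0" by simp
  have "\<bar>L u\<bar> / C \<le> norm u"
  proof (rule norm_tensor_greatest)
    fix ps assume "u = eval_sum tensor ps"
    then show "\<bar>L u\<bar> / C \<le> eval_sum (\<lambda>x y. norm x * norm y) ps"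
      using abs_eval_sum_le[of "\<lambda>x y. L (x \<otimes> y)" C ps] bound C
      by (simp add: eval_sum_linear[OF L] field_simps)
  qed
  then show ?thesis using C by (simp add: field_simps)
qed

definition elementary :: "'a::real_normed_vector \<Rightarrow> 'b::real_normed_vector
    \<Rightarrow> ('a, 'b) projective_tensor" where
  "elementary x y = to_completion (x \<otimes> y)"

lemma norm_elementary_le: "norm (elementary x y) \<le> norm x * norm y"
  using norm_eval_sum_tensor_le[of "[(x, y)]"] by (simp add: elementary_def norm_to_completion)

lemma bounded_bilinear_elementary: "bounded_bilinear elementary"
proof
  show "\<exists>K. \<forall>x y. norm (elementary (x::'a) (y::'b)) \<le> norm x * norm y * K"
    using norm_elementary_le by (intro exI[of _ 1]) auto
qed (simp_all add: elementary_def bilinear_ladd[OF bilinear_tensor] bilinear_radd[OF bilinear_tensor]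
      bilinear_lmul[OF bilinear_tensor] bilinear_rmul[OF bilinear_tensor]
      linear_add[OF linear_to_completion] linear_scale[OF linear_to_completion])

section \<open>Functionals on the projective tensor product\<close>

text \<open>Elements of the completion are bidual elements, so evaluating them at a functional \<open>L\<close> on the
  algebraic tensor product already is the extension of \<open>L\<close>, with no limits to be taken.\<close>

lemma extend_to_completion:
  fixes L :: "'a::real_normed_vector \<Rightarrow>\<^sub>L real"
  shows "\<exists>F :: 'a completion \<Rightarrow>\<^sub>L real. norm F \<le> norm L \<and>
    (\<forall>u. blinfun_apply F (to_completion u) = blinfun_apply L u)"
proof -
  let ?F = "\<lambda>u :: 'a completion. blinfun_apply (Rep_completion u) L"
  have b: "norm (?F u) \<le> norm L * norm u" for u
    using norm_blinfun[of "Rep_completion u" L] by (simp add: norm_completion.rep_eq mult.commute)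
  have bl: "bounded_linear ?F"
    by (rule bounded_linear_intro[where K = "norm L"])
      (use b in \<open>auto simp: plus_completion.rep_eq scaleR_completion.rep_eq blinfun.add_left
        blinfun.scaleR_left mult.commute\<close>)
  have "norm (Blinfun ?F) \<le> norm L"
    by (rule norm_blinfun_bound) (use b bl in \<open>auto simp: bounded_linear_Blinfun_apply\<close>)
  then show ?thesis
    using bl by (intro exI[of _ "Blinfun ?F"])
      (auto simp: bounded_linear_Blinfun_apply to_completion.rep_eq bidual_embed.rep_eq)
qed

lemma tensor_functional_exists:
  fixes f :: "'a::real_normed_vector \<Rightarrow>\<^sub>L real" and g :: "'b::real_normed_vector \<Rightarrow>\<^sub>L real"
  shows "\<exists>F :: ('a, 'b) projective_tensor \<Rightarrow>\<^sub>L real. norm F = norm f * norm g \<and>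
    (\<forall>x y. blinfun_apply F (elementary x y) = blinfun_apply f x * blinfun_apply g y)"
proof -
  have "bilinear (\<lambda>x y. blinfun_apply f x * blinfun_apply g y)"
    by (intro bilinear_mult_functionals bounded_linear.linear blinfun.bounded_linear_right)
  then obtain L :: "('a, 'b) tensor \<Rightarrow> real" where L: "linear L"
    "\<And>x y. L (x \<otimes> y) = blinfun_apply f x * blinfun_apply g y"
    using ex1_implies_ex[OF tensor_universal] by blast
  have "\<bar>L (x \<otimes> y)\<bar> \<le> norm f * norm g * (norm x * norm y)" for x y
    using mult_mono[OF norm_blinfun[of f x] norm_blinfun[of g y]]
    by (simp add: L(2) abs_mult mult.assoc mult.left_commute)
  then have bound: "\<bar>L u\<bar> \<le> norm f * norm g * norm u" for u
    by (intro linear_form_bound_from_elementary[OF L(1)]) auto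
  have bl: "bounded_linear L"
    by (rule bounded_linear_intro[where K = "norm f * norm g"])
      (use L(1) bound in \<open>auto simp: linear_add linear_scale mult.commute\<close>)
  obtain F :: "('a, 'b) projective_tensor \<Rightarrow>\<^sub>L real" where F: "norm F \<le> norm (Blinfun L)"
    "\<And>u. blinfun_apply F (to_completion u) = L u"
    using extend_to_completion[of "Blinfun L"] bl by (auto simp: bounded_linear_Blinfun_apply)
  have Fe: "blinfun_apply F (elementary x y) = blinfun_apply f x * blinfun_apply g y" for x y
    by (simp add: elementary_def F(2) L(2))
  have "norm (Blinfun L) \<le> norm f * norm g"
    by (rule norm_blinfun_bound) (use bound bl in \<open>auto simp: bounded_linear_Blinfun_apply\<close>)
  then have upper: "norm F \<le> norm f * norm g" using F(1) by linarith
  \<comment> \<open>For the lower bound the supremum is taken over \<open>x\<close> first, then over \<open>y\<close>.\<close>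
  have "norm (blinfun_apply g y *\<^sub>R f) \<le> norm F * norm y" for y
  proof (rule norm_blinfun_bound)
    fix x
    have "\<bar>blinfun_apply f x * blinfun_apply g y\<bar> \<le> norm F * norm (elementary x y)"
      using norm_blinfun[of F "elementary x y"] by (simp add: Fe)
    also have "\<dots> \<le> norm F * (norm x * norm y)"
      by (intro mult_left_mono norm_elementary_le) simp
    finally show "norm (blinfun_apply (blinfun_apply g y *\<^sub>R f) x) \<le> norm F * norm y * norm x"
      by (simp add: blinfun.scaleR_left mult_ac)
  qed simp
  then have "norm (norm f *\<^sub>R g) \<le> norm F"
    by (intro norm_blinfun_bound) (auto simp: blinfun.scaleR_left abs_mult mult.commute)
  with upper Fe show ?thesis by (intro exI[of _ F]) auto
qed

lemma norm_elementary: "norm (elementary x y) = norm x * norm y"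
proof (rule antisym[OF norm_elementary_le])
  obtain f where f: "norm f \<le> 1" "blinfun_apply f x = norm x" using norming_functional by blast
  obtain g where g: "norm g \<le> 1" "blinfun_apply g y = norm y" using norming_functional by blast
  obtain F where F: "norm F = norm f * norm g" "blinfun_apply F (elementary x y) = norm x * norm y"
    using tensor_functional_exists[of f g] f(2) g(2) by auto
  have "norm F \<le> 1" using mult_mono[OF f(1) g(1)] F(1) by simp
  then have "norm F * norm (elementary x y) \<le> norm (elementary x y)"
    by (simp add: mult_left_le_one_le)
  with norm_blinfun[of F "elementary x y"] F(2) show "norm x * norm y \<le> norm (elementary x y)"
    by simp
qed

text \<open>Otherwise the functional would be bounded by \<open>l\<close> times the norm on elementary tensors, hence
  on all tensors, hence by density on the completion.\<close>

lemma functional_almost_normed_by_elementary: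
  fixes G :: "('a::real_normed_vector, 'b::real_normed_vector) projective_tensor \<Rightarrow>\<^sub>L real"
  assumes l: "0 \<le> l" "l < norm G"
  shows "\<exists>x y. norm x = 1 \<and> norm y = 1 \<and> l \<le> blinfun_apply G (elementary x y)"
proof -
  interpret e: bounded_bilinear "elementary :: 'a \<Rightarrow> 'b \<Rightarrow> _" by (rule bounded_bilinear_elementary)
  have "\<exists>x y. \<bar>blinfun_apply G (elementary x y)\<bar> > l * (norm x * norm y)"
  proof (rule ccontr)
    assume "\<nexists>x y. \<bar>blinfun_apply G (elementary x y)\<bar> > l * (norm x * norm y)"
    then have le: "\<bar>blinfun_apply G (to_completion (x \<otimes> y))\<bar> \<le> l * (norm x * norm y)" for x y
      by (auto simp: elementary_def not_less)
    have "linear (\<lambda>u. blinfun_apply G (to_completion u))"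
      by (intro linearI) (simp_all add: linear_add[OF linear_to_completion]
          linear_scale[OF linear_to_completion] blinfun.add_right blinfun.scaleR_right)
    from linear_form_bound_from_elementary[OF this l(1) le]
    have "range to_completion \<subseteq> {v. \<bar>blinfun_apply G v\<bar> \<le> l * norm v}"
      by (auto simp: norm_to_completion)
    moreover have "closed {v. \<bar>blinfun_apply G v\<bar> \<le> l * norm v}"
      by (intro closed_Collect_le continuous_intros)
    ultimately have "closure (range to_completion) \<subseteq> {v. \<bar>blinfun_apply G v\<bar> \<le> l * norm v}"
      by (rule closure_minimal)
    then have "\<bar>blinfun_apply G v\<bar> \<le> l * norm v" for v
      by (auto simp: dense_to_completion)
    then have "norm G \<le> l"
      by (intro norm_blinfun_bound l(1)) simp
    with l(2) show False by simp
  qed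
  then obtain x y where xy: "l * (norm x * norm y) < \<bar>blinfun_apply G (elementary x y)\<bar>" by blast
  then have nz: "x \<noteq> 0" "y \<noteq> 0" by (auto simp: e.zero_left e.zero_right blinfun.zero_right)
  define s where "s = sgn (blinfun_apply G (elementary x y))"
  have s: "s \<noteq> 0" "\<bar>s\<bar> = 1"
    using xy mult_nonneg_nonneg[OF l(1), of "norm x * norm y"] by (auto simp: s_def sgn_if)
  have "s * blinfun_apply G (elementary x y) = \<bar>blinfun_apply G (elementary x y)\<bar>"
    by (simp add: s_def sgn_if)
  then have "blinfun_apply G (elementary (s *\<^sub>R sgn x) (sgn y))
      = \<bar>blinfun_apply G (elementary x y)\<bar> / (norm x * norm y)"
    by (simp add: sgn_div_norm e.scaleR_left e.scaleR_right blinfun.scaleR_right divide_inverse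
        mult_ac)
  also have "\<dots> \<ge> l" using xy nz by (simp add: field_simps)
  finally have "l \<le> blinfun_apply G (elementary (s *\<^sub>R sgn x) (sgn y))" .
  moreover have "norm (s *\<^sub>R sgn x) = 1" "norm (sgn y) = 1"
    using nz s by (simp_all add: norm_sgn)
  ultimately show ?thesis by blast
qed

section \<open>The property SD2P for the projective tensor product\<close>

text \<open>The SD2P in the form in which it is applied twice: for an indexed family of arbitrary non-zero
  functionals, with the norming vectors chosen.  Passing to the normalised functionals does not
  enlarge the cardinality, as they form an image of the index set.\<close>

lemma SD2P_less_family:
  fixes h :: "'i \<Rightarrow> 'a::real_normed_vector \<Rightarrow>\<^sub>L real"
  assumes X: "SD2P_less \<kappa> TYPE('a)" and I: "|I| <o \<kappa>" and l: "0 < l" "l < 1"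
    and nz: "\<And>i. i \<in> I \<Longrightarrow> h i \<noteq> 0"
  shows "\<exists>f :: 'a \<Rightarrow>\<^sub>L real. \<exists>x. norm f = 1 \<and> (\<forall>i\<in>I. norm (x i) = 1 \<and>
    l * norm (h i) \<le> blinfun_apply (h i) (x i) \<and> l \<le> blinfun_apply f (x i))"
proof -
  let ?A = "(\<lambda>i. sgn (h i)) ` I"
  have "?A \<subseteq> sphere 0 1" using nz by (auto simp: norm_sgn)
  moreover have "|?A| <o \<kappa>"
    by (rule ordLeq_ordLess_trans[OF card_of_image I])
  ultimately obtain B :: "'a set" and f where B: "B \<subseteq> sphere 0 1" and f: "f \<in> sphere 0 1"
    and n: "norms_by l B ?A" and fB: "\<forall>x\<in>B. blinfun_apply f x \<ge> l"
    using X l unfolding SD2P_less_def by (metis greaterThanLessThan_iff)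
  have "\<exists>x. norm x = 1 \<and> l * norm (h i) \<le> blinfun_apply (h i) x \<and> l \<le> blinfun_apply f x"
    if i: "i \<in> I" for i
  proof -
    obtain x where x: "x \<in> B" "blinfun_apply (sgn (h i)) x \<ge> l * norm (sgn (h i)) * norm x"
      using n i by (auto simp: norms_by_def)
    have "norm x = 1" using x(1) B by auto
    moreover have "l * norm (h i) \<le> blinfun_apply (h i) x"
      using x(2) \<open>norm x = 1\<close> nz[OF i]
      by (simp add: norm_sgn) (simp add: sgn_div_norm blinfun.scaleR_left field_simps)
    ultimately show ?thesis using fB x(1) by blast
  qed
  then obtain x where "\<forall>i\<in>I. norm (x i) = 1 \<and> l * norm (h i) \<le> blinfun_apply (h i) (x i) \<and>
      l \<le> blinfun_apply f (x i)"
    by metis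
  with f show ?thesis by (intro exI[of _ f] exI[of _ x]) auto
qed

theorem corollary5p6:
  fixes \<kappa> :: "'k rel"
  assumes "Cinfinite \<kappa>"
    and "infinite_dimensional TYPE('a::banach)" and "infinite_dimensional TYPE('b::banach)"
    and "SD2P_less \<kappa> TYPE('a)" and "SD2P_less \<kappa> TYPE('b)"
  shows "SD2P_less \<kappa> TYPE(('a, 'b) projective_tensor)"
  unfolding SD2P_less_def
proof (intro allI impI ballI)
  fix A :: "(('a, 'b) projective_tensor \<Rightarrow>\<^sub>L real) set" and l :: real
  assume A: "A \<subseteq> sphere 0 1" and card: "|A| <o \<kappa>" and l: "l \<in> {0<..<1}"
  interpret e: bounded_bilinear "elementary :: 'a \<Rightarrow> 'b \<Rightarrow> _" by (rule bounded_bilinear_elementary)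
  define m where "m = root 3 l"
  have m: "0 < m" "m < 1" and m3: "m * m * m = l"
    using l real_root_pow_pos[of 3 l] by (auto simp: m_def power3_eq_cube)
  have "\<forall>G\<in>A. \<exists>x y. norm x = 1 \<and> norm y = 1 \<and> m \<le> blinfun_apply G (elementary x y)"
    using A m by (intro ballI functional_almost_normed_by_elementary) auto
  then obtain x0 :: "_ \<Rightarrow> 'a" and y0 :: "_ \<Rightarrow> 'b" where
    xy0: "\<And>G. G \<in> A \<Longrightarrow> norm (x0 G) = 1" "\<And>G. G \<in> A \<Longrightarrow> norm (y0 G) = 1"
      "\<And>G. G \<in> A \<Longrightarrow> m \<le> blinfun_apply G (elementary (x0 G) (y0 G))"
    by metis
  define p where "p G = G o\<^sub>L Blinfun (\<lambda>x. elementary x (y0 G))" for G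
  have p: "blinfun_apply (p G) x = blinfun_apply G (elementary x (y0 G))" for G x
    by (simp add: p_def bounded_linear_Blinfun_apply e.bounded_linear_left)
  have np: "m \<le> norm (p G)" if "G \<in> A" for G
    using norm_blinfun[of "p G" "x0 G"] xy0[OF that] by (simp add: p)
  then obtain f x where f: "norm f = 1" and
    x: "\<And>G. G \<in> A \<Longrightarrow> norm (x G) = 1" "\<And>G. G \<in> A \<Longrightarrow> m * norm (p G) \<le> blinfun_apply (p G) (x G)"
      "\<And>G. G \<in> A \<Longrightarrow> m \<le> blinfun_apply f (x G)"
    using SD2P_less_family[OF assms(4) card m, of p] m by fastforce
  define q where "q G = G o\<^sub>L Blinfun (\<lambda>y. elementary (x G) y)" for G
  have q: "blinfun_apply (q G) y = blinfun_apply G (elementary (x G) y)" for G y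
    by (simp add: q_def bounded_linear_Blinfun_apply e.bounded_linear_right)
  have nq: "m * m \<le> norm (q G)" if G: "G \<in> A" for G
  proof -
    have "m * m \<le> m * norm (p G)" using np[OF G] m by simp
    also have "\<dots> \<le> blinfun_apply (q G) (y0 G)" using x(2)[OF G] by (simp add: p q)
    also have "\<dots> \<le> norm (q G)" using norm_blinfun[of "q G" "y0 G"] xy0(2)[OF G] by simp
    finally show ?thesis .
  qed
  have "q G \<noteq> 0" if "G \<in> A" for G
    using nq[OF that] mult_pos_pos[OF m(1) m(1)] by (metis norm_zero not_less)
  then obtain g y where g: "norm g = 1" and
    y: "\<And>G. G \<in> A \<Longrightarrow> norm (y G) = 1" "\<And>G. G \<in> A \<Longrightarrow> m * norm (q G) \<le> blinfun_apply (q G) (y G)"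
      "\<And>G. G \<in> A \<Longrightarrow> m \<le> blinfun_apply g (y G)"
    using SD2P_less_family[OF assms(5) card m, of q] by fastforce
  obtain F :: "('a, 'b) projective_tensor \<Rightarrow>\<^sub>L real" where F: "norm F = norm f * norm g"
    "\<And>x y. blinfun_apply F (elementary x y) = blinfun_apply f x * blinfun_apply g y"
    using tensor_functional_exists by blast
  let ?B = "(\<lambda>G. elementary (x G) (y G)) ` A"
  have B: "?B \<subseteq> sphere 0 1" using x(1) y(1) by (auto simp: norm_elementary)
  have norms: "l \<le> blinfun_apply G (elementary (x G) (y G))" if G: "G \<in> A" for G
  proof -
    have "l \<le> m * norm (q G)" using nq[OF G] m by (simp flip: m3 add: mult.assoc)
    also have "\<dots> \<le> blinfun_apply G (elementary (x G) (y G))" using y(2)[OF G] by (simp add: q)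
    finally show ?thesis .
  qed
  have large: "l \<le> blinfun_apply F (elementary (x G) (y G))" if G: "G \<in> A" for G
  proof -
    have "l \<le> m * m" using m by (simp flip: m3 add: mult_le_cancel_left1)
    also have "\<dots> \<le> blinfun_apply F (elementary (x G) (y G))"
      unfolding F(2) using x(3)[OF G] y(3)[OF G] m by (intro mult_mono) auto
    finally show ?thesis .
  qed
  have "norms_by l ?B A"
    unfolding norms_by_def
  proof
    fix G assume G: "G \<in> A"
    have "norm G = 1" "norm (elementary (x G) (y G)) = 1" "elementary (x G) (y G) \<noteq> 0"
      using A B G by auto
    with norms[OF G] G show "\<exists>v\<in>?B - {0}. blinfun_apply G v \<ge> l * norm G * norm v"
      by (intro bexI[of _ "elementary (x G) (y G)"]) auto
  qed
  with B large F(1) f g show "\<exists>B\<subseteq>sphere 0 1. \<exists>f\<in>sphere 0 1. norms_by l B A \<and>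
      (\<forall>x\<in>B. l \<le> blinfun_apply f x)"
    by (intro exI[of _ ?B] conjI bexI[of _ F]) auto
qed

end
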